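(* Let $i,k\ge 3$ be integers and let $r=\left\lfloor\frac{F_i-1}{F_k}\right\rfloor$. If either $r=0$, or $r\ge 1$ and $F_{k-2}F_i<(F_i-rF_k)F_{i+2}$, then $$g(F_i,F_{i+2},F_{i+k})=(F_i-1)F_{i+2}-F_i(rF_{k-2}+1).$$ Otherwise (that is, if $r\ge 1$ and $F_{k-2}F_i\ge (F_i-rF_k)F_{i+2}$), $$g(F_i,F_{i+2},F_{i+k})=(rF_k-1)F_{i+2}-F_i\bigl((r-1)F_{k-2}+1\bigr).$$
   Context: $F_n$ denotes the $n$-th Fibonacci number, with $F_1=F_2=1$ and $F_{n+2}=F_{n+1}+F_n$. For positive integers $s_1,\dots,s_n$ with greatest common divisor $1$, the Frobenius number $g(s_1,\dots,s_n)$ is the largest integer that is not representable as a nonnegative integer combination of $s_1,\dots,s_n$. *)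

theory Defs
  imports Complex_Main "HOL-Number_Theory.Fib"
begin

definition nonneg_comb :: "nat list \<Rightarrow> int \<Rightarrow> bool" where
  "nonneg_comb s x \<longleftrightarrow>
     (\<exists>c :: nat \<Rightarrow> nat. x = (\<Sum>j<length s. int (c j) * int (s ! j)))"

text \<open>The value is an integer because it is -1 when 1 is among the generators. It is
  meaningful only when the generators have greatest common divisor 1; otherwise there is no
  largest non-representable integer.\<close>

definition frobenius_number :: "nat list \<Rightarrow> int" where
  "frobenius_number s = (GREATEST x. \<not> nonneg_comb s x)"

text \<open>Integer-valued, so that the subtractions in the formulas do not truncate.\<close>

abbreviation F :: "nat \<Rightarrow> int" where
  "F n \<equiv> int (fib n)"

end

theory Submission
  imports Defs
begin

text \<open>Write \<open>a = F i\<close>, \<open>b = F (i + 2)\<close>, \<open>c = F (i + k)\<close>, \<open>p = F k\<close>, \<open>q = F (k - 2)\<close>. Everything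
  rests on the identity \<open>c = p * b - q * a\<close> (\<open>fib_add_fib_mult\<close>): modulo \<open>a\<close> the third
  generator is a multiple of the second, and \<open>p\<close> copies of \<open>b\<close> can be traded for a single \<open>c\<close>,
  which saves \<open>q * a\<close>.

  Since \<open>a\<close> and \<open>b\<close> are coprime, the residues modulo \<open>a\<close> are those of \<open>j * b\<close> with
  \<open>0 \<le> j < a\<close>. A combination \<open>v * b + z * c\<close> equals \<open>t * b - q * a * z\<close> with \<open>t = v + p * z\<close>, and
  for given \<open>t\<close> it is smallest when \<open>z = t div p\<close>. As \<open>F k \<ge> 2 * F (k - 2)\<close> and \<open>b \<ge> a\<close>, the saving is too
  small to make it worthwhile to replace \<open>t = j\<close> by some \<open>t = j + m * a\<close> (\<open>apery_shift_mono\<close>).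
  Hence the least representable number in the residue class of \<open>j * b\<close> is
  \<open>j * b - q * a * (j div p)\<close>, and the larger members of the class are representable too
  (\<open>nonneg_comb_iff_apery_le\<close>). So the Frobenius number is the maximum of these \<open>a\<close> values,
  minus \<open>a\<close>.

  The value grows with \<open>j\<close> inside a block of \<open>p\<close> consecutive indices, and from the end
  of one full block to the end of the next it grows by \<open>p * b - q * a = c > 0\<close>. The maximum is
  therefore attained at \<open>j = a - 1\<close> or at the end \<open>j = r * p - 1\<close> of the last full block below
  the block of \<open>a - 1\<close> (\<open>apery_le_last_or_block_end\<close>); comparing these two values gives the case
  distinction.\<close>

section \<open>Combinations of three generators\<close>

lemma nonneg_comb_triple:
  "nonneg_comb [a, b, c] x \<longleftrightarrow>
     (\<exists>u v z. 0 \<le> u \<and> 0 \<le> v \<and> 0 \<le> z \<and> x = u * int a + v * int b + z * int c)"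
  (is "?L \<longleftrightarrow> ?R")
proof
  assume ?L
  then obtain d :: "nat \<Rightarrow> nat"
    where "x = (\<Sum>j<length [a, b, c]. int (d j) * int ([a, b, c] ! j))"
    unfolding nonneg_comb_def by blast
  then have "x = int (d 0) * int a + int (d 1) * int b + int (d 2) * int c"
    by (simp add: numeral_2_eq_2)
  then show ?R using of_nat_0_le_iff by blast
next
  assume ?R
  then obtain u v z where uvz: "0 \<le> u" "0 \<le> v" "0 \<le> z" "x = u * int a + v * int b + z * int c"
    by blast
  define d where "d = (\<lambda>j::nat. nat (if j = 0 then u else if j = 1 then v else z))"
  have "x = (\<Sum>j<length [a, b, c]. int (d j) * int ([a, b, c] ! j))"
    using uvz by (simp add: d_def)
  then show ?L unfolding nonneg_comb_def by blast
qed

section \<open>The least representable number in each residue class\<close>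

text \<open>The value of \<open>(j mod p) * b + (j div p) * c\<close> when \<open>c = p * b - q * a\<close>. For \<open>0 \<le> j < a\<close>
  these numbers turn out to form the Apery set of \<open>a\<close> in the semigroup generated by
  \<open>a\<close>, \<open>b\<close>, \<open>c\<close>.\<close>

definition apery :: "int \<Rightarrow> int \<Rightarrow> int \<Rightarrow> int \<Rightarrow> int \<Rightarrow> int" where
  "apery a b p q j = j * b - q * a * (j div p)"

text \<open>For \<open>m \<ge> 1\<close>, going from \<open>j\<close> to \<open>j + m * a\<close> costs \<open>m * a * b\<close> and saves \<open>q * a\<close> for each additional
  multiple of \<open>p\<close> that becomes available. There are at most \<open>(j + m * a) / p \<le> 2 * m * a / p\<close>
  of those, so the saving is bounded by \<open>m * a * (2 * q * a / p) \<le> m * a * b\<close>.\<close>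

lemma apery_shift_mono:
  fixes a b p q j m :: int
  assumes "0 < p" "0 \<le> q" "2 * q * a \<le> p * b" "0 \<le> j" "j < a" "0 \<le> m"
  shows "apery a b p q j \<le> apery a b p q (j + m * a)"
proof (cases "m = 0")
  case False
  define d where "d = (j + m * a) div p - j div p"
  have m: "1 \<le> m" using False assms by simp
  have "p * ((j + m * a) div p) \<le> j + m * a"
    using assms(1) by (metis mult_div_mod_eq le_add_same_cancel1 pos_mod_sign)
  moreover have "0 \<le> p * (j div p)"
    using assms by (simp add: pos_imp_zdiv_nonneg_iff)
  moreover have "1 * a \<le> m * a"
    using m assms by (intro mult_right_mono) auto
  ultimately have "p * d \<le> 2 * (m * a)"
    using assms unfolding d_def right_diff_distrib by linarith
  then have "q * (p * d) \<le> q * (2 * (m * a))"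
    using assms by (intro mult_left_mono) auto
  also have "\<dots> = m * (2 * q * a)" by simp
  also have "\<dots> \<le> m * (p * b)"
    using assms by (intro mult_left_mono) auto
  finally have "p * (q * d) \<le> p * (m * b)" by (simp add: algebra_simps)
  then have "q * d \<le> m * b" using assms(1) by simp
  then have "a * (q * d) \<le> a * (m * b)"
    using assms by (intro mult_left_mono) auto
  then show ?thesis unfolding apery_def d_def by (simp add: algebra_simps)
qed simp

lemma nonneg_comb_iff_apery_le:
  fixes a b c :: nat and p q j x :: int
  assumes "coprime a b" "int c = p * int b - q * int a"
    and "0 < p" "0 \<le> q" "2 * q * int a \<le> p * int b"
    and "0 \<le> j" "j < int a" "int a dvd x - j * int b"
  shows "nonneg_comb [a, b, c] x \<longleftrightarrow> apery (int a) (int b) p q j \<le> x"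
proof
  assume "nonneg_comb [a, b, c] x"
  then obtain u v z where uvz: "0 \<le> u" "0 \<le> v" "0 \<le> z"
    and x: "x = u * int a + v * int b + z * int c"
    unfolding nonneg_comb_triple by blast
  define t where "t = v + p * z"
  have x': "x = u * int a + (t * int b - q * int a * z)"
    unfolding x t_def assms(2) by (simp add: algebra_simps)
  have "(t - j) * int b = (x - j * int b) + int a * (q * z - u)"
    unfolding x' by (simp add: algebra_simps)
  then have "int a dvd (t - j) * int b" using assms(8) by simp
  then have "int a dvd t - j" using assms(1) by (simp add: coprime_dvd_mult_left_iff)
  then obtain m where t: "t = j + m * int a"
    by (metis dvdE diff_eq_eq add.commute mult.commute)
  have "0 \<le> m"
  proof (rule ccontr)
    assume "\<not> 0 \<le> m"
    then have "m * int a \<le> -1 * int a" by (intro mult_right_mono) auto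
    moreover have "0 \<le> t" unfolding t_def using uvz assms(3) by simp
    ultimately show False using t assms(7) by simp
  qed
  have "z \<le> t div p"
    unfolding t_def using uvz assms(3) by (simp add: pos_imp_zdiv_nonneg_iff)
  then have "q * int a * z \<le> q * int a * (t div p)"
    using assms(4) by (intro mult_left_mono) auto
  then have "apery (int a) (int b) p q t \<le> x"
    unfolding x' apery_def using uvz(1) by (simp add: add_increasing)
  moreover have "apery (int a) (int b) p q j \<le> apery (int a) (int b) p q t"
    unfolding t using assms \<open>0 \<le> m\<close> by (intro apery_shift_mono) auto
  ultimately show "apery (int a) (int b) p q j \<le> x" by simp
next
  assume le: "apery (int a) (int b) p q j \<le> x"
  have "x - apery (int a) (int b) p q j = (x - j * int b) + int a * (q * (j div p))"
    unfolding apery_def by simp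
  then have "int a dvd x - apery (int a) (int b) p q j"
    using assms(8) by (metis dvd_add dvd_triv_left)
  then obtain n where n: "x - apery (int a) (int b) p q j = int a * n" by (rule dvdE)
  have "0 \<le> int a * n" using le n by simp
  then have "0 \<le> n" using assms by (simp add: zero_le_mult_iff)
  have "apery (int a) (int b) p q j = (p * (j div p) + j mod p) * int b - q * int a * (j div p)"
    unfolding apery_def by simp
  also have "\<dots> = (j mod p) * int b + (j div p) * int c"
    unfolding assms(2) by (simp only: algebra_simps)
  finally have "x = n * int a + (j mod p) * int b + (j div p) * int c"
    using n by (simp add: algebra_simps)
  moreover have "0 \<le> j mod p" "0 \<le> j div p"
    using assms by (simp_all add: pos_imp_zdiv_nonneg_iff)
  ultimately show "nonneg_comb [a, b, c] x"
    unfolding nonneg_comb_triple using \<open>0 \<le> n\<close> by blast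
qed

lemma coprime_residue_multiple:
  fixes a b x :: int
  assumes "coprime a b" "0 < a"
  obtains j where "0 \<le> j" "j < a" "a dvd x - j * b"
proof -
  obtain u v where uv: "u * a + v * b = 1"
    using bezout_int[of a b] assms(1) by auto
  define j where "j = (v * x) mod a"
  have "v * x - j = a * ((v * x) div a)" unfolding j_def by (simp add: minus_mod_eq_mult_div)
  moreover have "x = (u * a + v * b) * x" using uv by simp
  then have "x - j * b = a * (u * x) + (v * x - j) * b"
    by (simp add: algebra_simps)
  ultimately have "x - j * b = a * (u * x + ((v * x) div a) * b)"
    by (simp only: distrib_left mult.assoc)
  then have "a dvd x - j * b" by simp
  moreover have "0 \<le> j" "j < a" unfolding j_def using assms(2) by simp_all
  ultimately show thesis using that by blast
qed

text \<open>The largest number that is not representable in the class of \<open>j * b\<close> lies \<open>a\<close> below the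
  Apery element of that class, so the class with the largest Apery element decides.\<close>

lemma frobenius_number_eq_apery_max:
  fixes a b c :: nat and p q j0 :: int
  assumes "coprime a b" "int c = p * int b - q * int a"
    and "0 < p" "0 \<le> q" "2 * q * int a \<le> p * int b"
    and "0 \<le> j0" "j0 < int a"
    and max: "\<And>j. 0 \<le> j \<Longrightarrow> j < int a \<Longrightarrow>
               apery (int a) (int b) p q j \<le> apery (int a) (int b) p q j0"
  shows "frobenius_number [a, b, c] = apery (int a) (int b) p q j0 - int a"
  unfolding frobenius_number_def
proof (rule Greatest_equality)
  let ?g = "apery (int a) (int b) p q j0 - int a"
  have "?g - j0 * int b = int a * (- q * (j0 div p) - 1)"
    unfolding apery_def by (simp add: algebra_simps)
  then have "int a dvd ?g - j0 * int b" by simp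
  then show "\<not> nonneg_comb [a, b, c] ?g"
    using nonneg_comb_iff_apery_le[OF assms(1-7)] assms(6,7) by simp
next
  fix x
  assume non: "\<not> nonneg_comb [a, b, c] x"
  have "coprime (int a) (int b)" "0 < int a" using assms by simp_all
  then obtain j where j: "0 \<le> j" "j < int a" "int a dvd x - j * int b"
    by (rule coprime_residue_multiple)
  have lt: "x < apery (int a) (int b) p q j"
    using non nonneg_comb_iff_apery_le[OF assms(1-5) j] by simp
  have "apery (int a) (int b) p q j - x = int a * (- q * (j div p)) - (x - j * int b)"
    unfolding apery_def by simp
  then have "int a dvd apery (int a) (int b) p q j - x"
    using j(3) by (metis dvd_diff dvd_triv_left)
  then have "int a \<le> apery (int a) (int b) p q j - x"
    using lt by (simp add: zdvd_imp_le)
  then show "x \<le> apery (int a) (int b) p q j0 - int a"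
    using max[OF j(1,2)] by simp
qed

section \<open>Locating the maximum\<close>

lemma div_block_end:
  fixes p s :: int
  assumes "0 < p"
  shows "(s * p - 1) div p = s - 1"
proof -
  have "s * p - 1 = (p - 1) + p * (s - 1)" by (simp add: algebra_simps)
  then show ?thesis using assms by (simp only: div_mult_self2) (simp add: div_pos_pos_trivial)
qed

text \<open>For \<open>j\<close> in the block of \<open>a - 1\<close>, the number \<open>j div p\<close> is the same as for \<open>a - 1\<close> and only
  the term \<open>j * b\<close> matters. In an earlier block \<open>t = j div p < r\<close>, the value is at most
  the one at the block end \<open>(t + 1) * p - 1\<close>, which is \<open>(t + 1) * (p * b - q * a) + q * a - b\<close>
  and hence nondecreasing in \<open>t\<close>.\<close>

lemma apery_le_last_or_block_end:
  fixes a b p q j r :: int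
  assumes "0 < p" "0 \<le> b" "q * a \<le> p * b" "0 \<le> j" "j < a" "r = (a - 1) div p"
  shows "apery a b p q j \<le> apery a b p q (a - 1) \<or>
         1 \<le> r \<and> apery a b p q j \<le> apery a b p q (r * p - 1)"
proof (cases "j div p = r")
  case True
  have "j * b \<le> (a - 1) * b" using assms by (intro mult_right_mono) auto
  then show ?thesis using True assms(6) unfolding apery_def by simp
next
  case False
  define t where "t = j div p"
  have "t \<le> r" unfolding t_def assms(6) using assms by (intro zdiv_mono1) auto
  then have t: "t + 1 \<le> r" using False t_def by simp
  have "0 \<le> t" unfolding t_def using assms by (simp add: pos_imp_zdiv_nonneg_iff)
  have "j = p * t + j mod p" unfolding t_def by simp
  moreover have "j mod p < p" using assms by simp
  ultimately have "j \<le> (t + 1) * p - 1" unfolding distrib_right by (simp add: mult.commute)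
  then have "j * b \<le> ((t + 1) * p - 1) * b" using assms by (intro mult_right_mono) auto
  then have "apery a b p q j \<le> (t + 1) * (p * b - q * a) + q * a - b"
    unfolding apery_def t_def[symmetric] by (simp add: algebra_simps)
  also have "\<dots> \<le> r * (p * b - q * a) + q * a - b"
    using mult_right_mono[OF t, of "p * b - q * a"] assms(3) by simp
  also have "\<dots> = apery a b p q (r * p - 1)"
    unfolding apery_def div_block_end[OF assms(1)] by (simp add: algebra_simps)
  finally show ?thesis using t \<open>0 \<le> t\<close> by simp
qed

text \<open>The Frobenius number of any triple \<open>a, b, p * b - q * a\<close> for which trading \<open>b\<close>s for the
  third generator saves at most half of their total value.\<close>

theorem frobenius_number_triple:
  fixes a b c :: nat and p q r :: int
  assumes "coprime a b" "0 < a" "int c = p * int b - q * int a"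
    and "0 < p" "0 \<le> q" "2 * q * int a \<le> p * int b"
    and r: "r = (int a - 1) div p"
  shows "frobenius_number [a, b, c] =
    (if r = 0 \<or> (r \<ge> 1 \<and> q * int a < (int a - r * p) * int b)
     then (int a - 1) * int b - int a * (r * q + 1)
     else (r * p - 1) * int b - int a * ((r - 1) * q + 1))"
proof -
  let ?w = "apery (int a) (int b) p q"
  let ?C = "r = 0 \<or> (r \<ge> 1 \<and> q * int a < (int a - r * p) * int b)"
  have r0: "0 \<le> r" unfolding r using assms by (simp add: pos_imp_zdiv_nonneg_iff)
  have last: "?w (int a - 1) = (int a - 1) * int b - q * int a * r"
    unfolding apery_def r by simp
  have blk: "?w (r * p - 1) = (r * p - 1) * int b - q * int a * (r - 1)"
    unfolding apery_def div_block_end[OF assms(4)] by simp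
  have diff: "?w (int a - 1) - ?w (r * p - 1) = (int a - r * p) * int b - q * int a"
    unfolding last blk by (simp add: algebra_simps)
  have "0 \<le> q * int a" using assms by simp
  then have qa: "q * int a \<le> p * int b" using assms(6) by simp
  note bound = apery_le_last_or_block_end[OF assms(4) of_nat_0_le_iff qa _ _ r]
  note frob = frobenius_number_eq_apery_max[OF assms(1,3-6)]
  show ?thesis
  proof (cases ?C)
    case True
    have "frobenius_number [a, b, c] = ?w (int a - 1) - int a"
    proof (rule frob)
      fix j assume "0 \<le> j" "j < int a"
      then show "?w j \<le> ?w (int a - 1)" using bound[of j] True diff by auto
    qed (use assms(2) in auto)
    then show ?thesis using True last by (simp add: algebra_simps)
  next
    case False
    have r1: "1 \<le> r" and ge: "(int a - r * p) * int b \<le> q * int a" using False r0 by auto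
    have "r * p \<le> int a - 1"
      unfolding r using assms(4) by (metis div_mult_mod_eq le_add_same_cancel1 pos_mod_sign)
    moreover have "1 * 1 \<le> r * p" using r1 assms(4) by (intro mult_mono) auto
    ultimately have rng: "0 \<le> r * p - 1" "r * p - 1 < int a" by simp_all
    have "frobenius_number [a, b, c] = ?w (r * p - 1) - int a"
    proof (rule frob[OF rng])
      fix j assume "0 \<le> j" "j < int a"
      then show "?w j \<le> ?w (r * p - 1)" using bound[of j] ge diff by auto
    qed
    then show ?thesis using False blk by (simp add: algebra_simps)
  qed
qed

section \<open>The Fibonacci triple\<close>

lemma fib_add_fib_mult: "fib (i + n + 2) + fib n * fib i = fib (n + 2) * fib (i + 2)"
proof (induction n rule: fib.induct)
  case (3 n)
  then show ?case by (simp add: algebra_simps)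
qed (simp_all add: algebra_simps)

lemma coprime_fib_add_2: "coprime (fib n) (fib (n + 2))"
proof -
  have "fib (n + 2) = fib n + fib (Suc n)" by simp
  then show ?thesis using coprime_fib_Suc_nat[of n] by (simp only: coprime_iff_gcd_eq_1 gcd_add2)
qed

theorem theorem1p1:
  fixes i k :: nat and r :: int
  assumes "i \<ge> 3" and "k \<ge> 3"
    and "r = \<lfloor>real_of_int (F i - 1) / real_of_int (F k)\<rfloor>"
  shows "frobenius_number [fib i, fib (i + 2), fib (i + k)] =
    (if r = 0 \<or> (r \<ge> 1 \<and> F (k - 2) * F i < (F i - r * F k) * F (i + 2))
     then (F i - 1) * F (i + 2) - F i * (r * F (k - 2) + 1)
     else (r * F k - 1) * F (i + 2) - F i * ((r - 1) * F (k - 2) + 1))"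
proof (rule frobenius_number_triple)
  obtain n where k: "k = n + 2" 
    using assms(2) that[of "k - 2"] by simp
  show "coprime (fib i) (fib (i + 2))" by (rule coprime_fib_add_2)
  show "0 < fib i" "0 < F k" using assms(1,2) by (simp_all add: fib_neq_0_nat)
  have "F (i + k) + F (k - 2) * F i = F k * F (i + 2)"
    using arg_cong[OF fib_add_fib_mult[of i n], of int] by (simp add: k add.assoc)
  then show "F (i + k) = F k * F (i + 2) - F (k - 2) * F i" by simp
  show "0 \<le> F (k - 2)" by simp
  have "2 * fib (k - 2) \<le> fib k" unfolding k by (simp add: fib_mono)
  then have "2 * fib (k - 2) * fib i \<le> fib k * fib (i + 2)"
    by (intro mult_mono fib_mono) auto
  then show "2 * F (k - 2) * F i \<le> F k * F (i + 2)"
    by (metis of_nat_le_iff of_nat_mult of_nat_numeral)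
  show "r = (F i - 1) div F k" unfolding assms(3) by (rule floor_divide_of_int_eq)
qed

end
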